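(* Let $f(x)=\frac1n\sum_{i=1}^nf_i(x)$ where each $f_i:\mathbb{R}^d\to\mathbb{R}$, $i=1,\ldots,n$, is differentiable, convex and symmetrically $(L_0,L_1)$-smooth with $L_0>0$, $L_1>0$, and suppose there exists $x^*\in\mathbb{R}^d$ such that $x^*\in\arg\min_{x\in\mathbb{R}^d}f_i(x)$ for all $i=1,\ldots,n$. Let $\nu$ be the real number with $\nu=e^{-\nu}$ and $0<\eta\le\frac\nu2$. Let $x^0\in\mathbb{R}^d$ and let $(x^k)_{k\ge0}$ be the iterates of $(L_0,L_1)$-SGD: $$x^{k+1}=x^k-\frac{\eta}{L_0+L_1\|\nabla f_{\xi^k}(x^k)\|}\nabla f_{\xi^k}(x^k),$$ where $\xi^k$ is sampled uniformly at random from $\{1,\ldots,n\}$, independently for each $k$. Then for every integer $N\ge0$ $$\min_{k=0,\ldots,N}\mathbb{E}\left[\min\left\{\frac{\nu L_0}{4nL_1^2},\ f(x^k)-f(x^* )\right\}\right]\le\frac{2L_0\|x^0-x^*\|^2}{\eta(N+1)}.$$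
   Context: $\|\cdot\|$ is the Euclidean norm. A differentiable $g:\mathbb{R}^d\to\mathbb{R}$ is convex if $g(y)\ge g(x)+\langle\nabla g(x),y-x\rangle$ for all $x,y$. It is symmetrically $(L_0,L_1)$-smooth if for all $x,y\in\mathbb{R}^d$ $$\|\nabla g(x)-\nabla g(y)\|\le\Big(L_0+L_1\sup_{u\in[x,y]}\|\nabla g(u)\|\Big)\|x-y\|,$$ where $[x,y]$ is the line segment between $x$ and $y$. *)

theory Defs
  imports "HOL-Probability.Probability"
begin

definition gradient :: "('a::euclidean_space \<Rightarrow> real) \<Rightarrow> 'a \<Rightarrow> 'a" where
  "gradient g x = (THE v. GDERIV g x :> v)"

lemma GDERIV_gradient:
  fixes g :: "'a::euclidean_space \<Rightarrow> real"
  assumes "g differentiable (at x)"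
  shows "GDERIV g x :> gradient g x"
proof -
  obtain D where D: "(g has_derivative D) (at x)"
    using assms by (auto simp: differentiable_def)
  interpret linear D
    using D by (rule has_derivative_linear)
  define v where "v = (\<Sum>b\<in>Basis. D b *\<^sub>R b)"
  have "D h = h \<bullet> v" for h
  proof -
    have "D h = D (\<Sum>b\<in>Basis. (h \<bullet> b) *\<^sub>R b)"
      by (simp add: euclidean_representation)
    also have "\<dots> = h \<bullet> v"
      unfolding sum scale v_def inner_sum_right by (simp add: mult.commute)
    finally show ?thesis .
  qed
  then have "D = (\<lambda>h. h \<bullet> v)"
    by (rule ext)
  with D have v: "GDERIV g x :> v"
    by (simp add: gderiv_def)
  have "w = v" if "GDERIV g x :> w" for w
  proof -
    have "(\<lambda>h. h \<bullet> w) = (\<lambda>h. h \<bullet> v)"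
      using that v unfolding gderiv_def by (rule has_derivative_unique)
    then show ?thesis
      by (metis inner_commute vector_eq_ldot)
  qed
  with v show ?thesis
    unfolding gradient_def by (rule theI)
qed

definition convex_gradient :: "('a::euclidean_space \<Rightarrow> real) \<Rightarrow> bool" where
  "convex_gradient g \<longleftrightarrow> (\<forall>x y. g y \<ge> g x + gradient g x \<bullet> (y - x))"

text \<open>The supremum is taken in the extended reals: if the gradient is unbounded on a segment, the
  bound there is infinite, whereas \<open>Sup\<close> on the reals would return an unspecified value.\<close>

definition symmetrically_smooth :: "real \<Rightarrow> real \<Rightarrow> ('a::euclidean_space \<Rightarrow> real) \<Rightarrow> bool" where
  "symmetrically_smooth L0 L1 g \<longleftrightarrow> (\<forall>x y.
     ereal (norm (gradient g x - gradient g y))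
       \<le> (ereal L0 + ereal L1 * (SUP u\<in>closed_segment x y. ereal (norm (gradient g u))))
           * ereal (norm (x - y)))"

text \<open>Iterates along one sequence \<open>s\<close> of sampled indices; randomness enters by taking \<open>s\<close> to be
  a sample path.\<close>

primrec sgd_iterate ::
  "real \<Rightarrow> real \<Rightarrow> real \<Rightarrow> (nat \<Rightarrow> 'a::euclidean_space \<Rightarrow> real) \<Rightarrow> 'a \<Rightarrow> (nat \<Rightarrow> nat) \<Rightarrow> nat \<Rightarrow> 'a" where
  "sgd_iterate L0 L1 \<eta> f x0 s 0 = x0"
| "sgd_iterate L0 L1 \<eta> f x0 s (Suc k) =
     (let x = sgd_iterate L0 L1 \<eta> f x0 s k; g = gradient (f (s k)) x
      in x - (\<eta> / (L0 + L1 * norm g)) *\<^sub>R g)"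

end

theory Submission
  imports Defs
begin

text \<open>Along a segment the symmetric smoothness condition controls the growth of the gradient
  exponentially; moving from \<open>x\<close> a distance \<open>\<nu> G / (L0 + L1 G)\<close> against the gradient of norm \<open>G\<close>
  then shows that the gap \<open>g x - g xstar\<close> is at least \<open>\<nu> G\<^sup>2 / (2 (L0 + L1 G))\<close>. By convexity and this
  bound, a step on \<open>fi i\<close> lowers the squared distance to \<open>xstar\<close> by at least \<open>\<eta> \<delta> / (L0 + L1 G)\<close>, where
  \<open>\<delta>\<close> is the gap of \<open>fi i\<close>. If \<open>L1 G \<le> L0\<close> this is at least \<open>\<eta> \<delta> / (2 L0)\<close>, and otherwise the gap
  bound makes it at least \<open>\<eta> \<nu> / (8 L1\<^sup>2)\<close>. Averaging over the fresh index and telescoping the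
  expected squared distance gives the rate.\<close>

section \<open>Gradient bounds from convexity and symmetric smoothness\<close>

text \<open>The convexity inequality at \<open>u\<close>, tested one unit along the gradient, bounds
  the gradient norm by a difference of two values of \<open>g\<close>, and \<open>g\<close> is
  bounded on balls by continuity. This makes the suprema in the smoothness condition finite.\<close>

lemma bounded_gradient_image:
  fixes g :: "'a::euclidean_space \<Rightarrow> real"
  assumes diff: "\<And>x. g differentiable (at x)" and conv: "convex_gradient g" and "bounded S"
  shows "bounded (gradient g ` S)"
proof -
  obtain r where r: "\<And>u. u \<in> S \<Longrightarrow> norm u \<le> r"
    using \<open>bounded S\<close> by (auto simp: bounded_iff)
  have "continuous_on (cball 0 (r + 1)) g"
    by (intro differentiable_imp_continuous_on differentiable_at_imp_differentiable_on diff)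
  then have "bounded (g ` cball 0 (r + 1))"
    by (intro compact_imp_bounded compact_continuous_image) auto
  then obtain B where "\<forall>u\<in>cball 0 (r + 1). \<bar>g u\<bar> \<le> B"
    by (auto simp: bounded_iff)
  then have B: "\<bar>g u\<bar> \<le> B" if "norm u \<le> r + 1" for u
    using that by simp
  have "norm (gradient g u) \<le> 2 * B" if "u \<in> S" for u
  proof -
    \<comment> \<open>The unit gradient direction, or zero if the gradient vanishes; both facts
      about \<open>v\<close> hold in either case. The unit step is why the ball has radius
      \<open>r + 1\<close>.\<close>
    define v where "v = sgn (gradient g u)"
    have v: "norm v \<le> 1" "gradient g u \<bullet> v = norm (gradient g u)"
      by (cases "gradient g u = 0";
          simp add: v_def norm_sgn sgn_div_norm dot_square_norm power2_eq_square)+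
    have "norm (u + v) \<le> r + 1"
      using norm_triangle_ineq[of u v] v r[OF that] by linarith
    then have "\<bar>g (u + v)\<bar> \<le> B" "\<bar>g u\<bar> \<le> B"
      using r[OF that] by (auto intro: B)
    moreover have "g (u + v) \<ge> g u + norm (gradient g u)"
      using conv v by (auto simp: convex_gradient_def dest: spec2[of _ u "u + v"])
    ultimately show ?thesis by linarith
  qed
  then show ?thesis by (auto simp: bounded_iff)
qed

text \<open>Smoothness between \<open>x\<close> and the points of the segment bounds the supremum
  \<open>S\<close> of the gradient norms in terms of itself:
  \<open>S \<le> norm (gradient g x) + (L0 + L1 * S) * d\<close>. As \<open>S\<close> is finite and
  \<open>L1 * d < 1\<close>, this can be solved for \<open>L0 + L1 * S\<close>, which controls both
  conclusions.\<close>

lemma symmetrically_smooth_short_step: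
  fixes g :: "'a::euclidean_space \<Rightarrow> real"
  assumes sm: "symmetrically_smooth L0 L1 g" and L: "0 \<le> L0" "0 \<le> L1"
    and bd: "bounded (gradient g ` closed_segment x y)" and short: "L1 * norm (x - y) < 1"
  shows "norm (gradient g x - gradient g y)
      \<le> (L0 + L1 * norm (gradient g x)) / (1 - L1 * norm (x - y)) * norm (x - y)"
    and "L0 + L1 * norm (gradient g y)
      \<le> (L0 + L1 * norm (gradient g x)) / (1 - L1 * norm (x - y))"
proof -
  define d where "d = norm (x - y)"
  define S where "S = (SUP u\<in>closed_segment x y. norm (gradient g u))"
  have bdd: "bdd_above ((\<lambda>u. norm (gradient g u)) ` closed_segment x y)"
    using bd unfolding bounded_iff bdd_above_def by auto
  have S: "norm (gradient g u) \<le> S" if "u \<in> closed_segment x y" for u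
    unfolding S_def by (intro cSUP_upper bdd that)
  have S0: "0 \<le> S"
    using S[of x] norm_ge_zero[of "gradient g x"] by (simp del: norm_ge_zero)
  have lip: "norm (gradient g x - gradient g u) \<le> (L0 + L1 * S) * norm (x - u)"
    if u: "u \<in> closed_segment x y" for u
  proof -
    \<comment> \<open>Smoothness is applied to the pair \<open>x\<close>, \<open>u\<close>; its
      extended-real supremum runs over a subsegment and is therefore at most the real number
      \<open>S\<close>.\<close>
    have "closed_segment x u \<subseteq> closed_segment x y"
      using u by (simp add: subset_closed_segment)
    then have "(SUP w\<in>closed_segment x u. ereal (norm (gradient g w))) \<le> ereal S"
      by (intro SUP_least) (auto intro: S)
    then have "(ereal L0 + ereal L1 * (SUP w\<in>closed_segment x u. ereal (norm (gradient g w))))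
        * ereal (norm (x - u)) \<le> (ereal L0 + ereal L1 * ereal S) * ereal (norm (x - u))"
      using L by (intro ereal_mult_right_mono add_left_mono ereal_mult_left_mono) auto
    then have "ereal (norm (gradient g x - gradient g u))
        \<le> (ereal L0 + ereal L1 * ereal S) * ereal (norm (x - u))"
      using sm unfolding symmetrically_smooth_def by (blast intro: order_trans)
    then show ?thesis by simp
  qed
  have "S \<le> norm (gradient g x) + (L0 + L1 * S) * d"
    unfolding S_def
  proof (rule cSUP_least, goal_cases)
    case (2 u)
    have "norm (x - u) \<le> d"
      using segment_bound(1)[OF 2] by (simp add: d_def norm_minus_commute)
    then have "(L0 + L1 * S) * norm (x - u) \<le> (L0 + L1 * S) * d"
      using L S0 by (intro mult_left_mono) auto
    with lip[OF 2] norm_triangle_sub[of "gradient g u" "gradient g x"] show ?case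
      by (simp add: norm_minus_commute flip: S_def)
  qed auto
  \<comment> \<open>Multiplying by \<open>L1\<close> and adding \<open>L0\<close> makes
    \<open>L0 + L1 * S\<close> the unknown on both sides; its coefficient \<open>1 - L1 * d\<close>
    is positive by \<open>short\<close>.\<close>
  then have "L1 * S \<le> L1 * (norm (gradient g x) + (L0 + L1 * S) * d)"
    using L by (intro mult_left_mono)
  then have "(L0 + L1 * S) * (1 - L1 * d) \<le> L0 + L1 * norm (gradient g x)"
    by (simp add: algebra_simps)
  then have K: "L0 + L1 * S \<le> (L0 + L1 * norm (gradient g x)) / (1 - L1 * d)"
    using short by (simp add: d_def pos_le_divide_eq)
  show "norm (gradient g x - gradient g y)
      \<le> (L0 + L1 * norm (gradient g x)) / (1 - L1 * norm (x - y)) * norm (x - y)"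
    using lip[of y] mult_right_mono[OF K, of d] by (simp add: d_def)
  have "L1 * norm (gradient g y) \<le> L1 * S"
    using L by (intro mult_left_mono S) auto
  then show "L0 + L1 * norm (gradient g y)
      \<le> (L0 + L1 * norm (gradient g x)) / (1 - L1 * norm (x - y))"
    using K by (simp add: d_def)
qed

text \<open>A discrete Gronwall argument: the short-step bound is iterated along \<open>m\<close> equal pieces of the
  segment, and \<open>m\<close> tends to infinity.\<close>

lemma symmetrically_smooth_exp_bound:
  fixes g :: "'a::euclidean_space \<Rightarrow> real"
  assumes sm: "symmetrically_smooth L0 L1 g" and L: "0 \<le> L0" "0 \<le> L1"
    and bd: "\<And>u v. bounded (gradient g ` closed_segment u v)"
  shows "norm (gradient g x - gradient g y)
      \<le> (L0 + L1 * norm (gradient g x)) * exp (L1 * norm (x - y)) * norm (x - y)"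
proof -
  define d where "d = norm (x - y)"
  define W where "W u = L0 + L1 * norm (gradient g u)" for u
  have W0: "0 \<le> W u" for u using L by (simp add: W_def)
  \<comment> \<open>The lower bound on \<open>m\<close> makes each piece, of length
    \<open>d / m\<close>, short enough for the previous lemma. The denominator is
    \<open>q ^ m\<close>, written so as to match the limit defining the exponential.\<close>
  have bound: "norm (gradient g x - gradient g y) \<le> d * W x / (1 + - (L1 * d) / real m) ^ m"
    if m: "real m > L1 * d" for m :: nat
  proof -
    have "0 \<le> L1 * d" using L by (simp add: d_def)
    then have m0: "0 < real m" using m by linarith
    define q where "q = 1 - L1 * d / m"
    have q: "0 < q" "q \<le> 1" using m m0 L by (auto simp: q_def d_def)
    define p where "p j = x + (real j / m) *\<^sub>R (y - x)" for j
    have pd: "norm (p j - p (Suc j)) = d / m" for j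
    proof -
      have "p j - p (Suc j) = (1 / m) *\<^sub>R (x - y)"
        using m0 by (simp add: p_def algebra_simps add_divide_distrib)
      then show ?thesis by (simp add: d_def)
    qed
    have short: "L1 * norm (p j - p (Suc j)) < 1" for j
      using q by (simp add: pd q_def)
    have step: "norm (gradient g (p j) - gradient g (p (Suc j))) \<le> W (p j) / q * (d / m)"
      "W (p (Suc j)) \<le> W (p j) / q" for j
      using symmetrically_smooth_short_step[OF sm L bd short[of j]]
      by (simp_all add: W_def pd q_def)
    have Wj: "W (p j) \<le> W x / q ^ j" for j
    proof (induction j)
      case (Suc j)
      have "W (p (Suc j)) \<le> (W x / q ^ j) / q"
        using step(2)[of j] divide_right_mono[OF Suc, of q] q by linarith
      then show ?case by (simp add: mult.commute)
    qed (simp add: p_def)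
    have "norm (gradient g x - gradient g (p j)) \<le> real j * (d / m) * (W x / q ^ j)" for j
    proof (induction j)
      case (Suc j)
      \<comment> \<open>Since \<open>q \<le> 1\<close>, the exponent may be raised, so that the old
        pieces and the new one share a single factor.\<close>
      have c: "W x / q ^ j \<le> W x / q ^ Suc j"
        using q W0[of x] by (intro divide_left_mono) (auto simp: mult_le_cancel_right1 mult_left_le_one_le)
      have dm: "0 \<le> d / m" by (simp add: d_def)
      have "norm (gradient g (p j) - gradient g (p (Suc j))) \<le> (W x / q ^ Suc j) * (d / m)"
        using step(1)[of j] mult_right_mono[OF divide_right_mono[OF Wj[of j], of q] dm] q
        by (simp add: mult.commute)
      moreover have "real j * (d / m) * (W x / q ^ j) \<le> real j * (d / m) * (W x / q ^ Suc j)"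
        using dm by (intro mult_left_mono c mult_nonneg_nonneg) auto
      ultimately have "norm (gradient g x - gradient g (p j))
          + norm (gradient g (p j) - gradient g (p (Suc j)))
          \<le> real (Suc j) * (d / m) * (W x / q ^ Suc j)"
        using Suc by (simp only: of_nat_Suc distrib_right mult_1_left mult.commute[of "W x / q ^ Suc j"])
      moreover have "norm (gradient g x - gradient g (p (Suc j)))
          \<le> norm (gradient g x - gradient g (p j)) + norm (gradient g (p j) - gradient g (p (Suc j)))"
        by (metis diff_add_cancel add_diff_eq norm_triangle_ineq)
      ultimately show ?case by linarith
    qed (simp add: p_def)
    from this[of m] show ?thesis
      using m0 by (simp add: p_def q_def)
  qed
  have "eventually (\<lambda>m. real m > L1 * d) sequentially"
    using filterlim_real_sequentially by (simp add: filterlim_at_top_dense)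
  then have ev: "eventually (\<lambda>m. norm (gradient g x - gradient g y)
      \<le> d * W x / (1 + - (L1 * d) / real m) ^ m) sequentially"
    by eventually_elim (rule bound)
  have "(\<lambda>m. d * W x / (1 + - (L1 * d) / real m) ^ m) \<longlonglongrightarrow> d * W x / exp (- (L1 * d))"
    by (intro tendsto_intros tendsto_exp_limit_sequentially) simp
  from tendsto_lowerbound[OF this ev] show ?thesis
    by (simp add: d_def W_def exp_minus field_simps)
qed

section \<open>Optimality gap and one deterministic step\<close>

text \<open>Along the unit direction against the gradient, the exponential bound keeps the slope of
  \<open>g\<close> below \<open>- G + K * t / \<nu>\<close> as long as \<open>t \<le> r\<close>.
  Integrating gives a quadratic majorant, whose value at its minimiser \<open>r\<close> still cannot
  fall below \<open>g xstar\<close>.\<close>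

lemma gradient_norm_le_gap:
  fixes g :: "'a::euclidean_space \<Rightarrow> real"
  assumes diff: "\<And>x. g differentiable (at x)" and conv: "convex_gradient g"
    and sm: "symmetrically_smooth L0 L1 g" and L: "0 < L0" "0 < L1"
    and min: "\<And>y. g xstar \<le> g y" and nu: "\<nu> = exp (- \<nu>)"
  shows "\<nu> * (norm (gradient g x))\<^sup>2 / (2 * (L0 + L1 * norm (gradient g x))) \<le> g x - g xstar"
proof -
  define G where "G = norm (gradient g x)"
  define K where "K = L0 + L1 * G"
  define v where "v = sgn (gradient g x)"
  \<comment> \<open>The minimiser of \<open>- G * t + K * t\<^sup>2 / (2 * \<nu>)\<close>. It also
    satisfies \<open>L1 * r \<le> \<nu>\<close>, because \<open>L1 * G \<le> K\<close>, so the
    exponential factor never exceeds \<open>exp \<nu>\<close>.\<close>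
  define r where "r = \<nu> * G / K"
  have nu0: "0 < \<nu>" by (subst nu) simp
  have G0: "0 \<le> G" by (simp add: G_def)
  have K0: "0 < K" using L G0 by (simp add: K_def add_pos_nonneg)
  have r0: "0 \<le> r" using nu0 G0 K0 by (simp add: r_def)
  have rL: "L1 * r \<le> \<nu>"
    using nu0 K0 L by (simp add: r_def K_def pos_divide_le_eq algebra_simps)
  \<comment> \<open>The fixed-point equation for \<nu> makes the largest exponential factor on the
    step equal to the constant in the quadratic.\<close>
  have exp_nu: "exp \<nu> = 1 / \<nu>"
    using nu by (metis exp_minus inverse_eq_divide inverse_inverse_eq)
  have v: "norm v \<le> 1" "gradient g x \<bullet> v = G"
    by (cases "gradient g x = 0";
        simp add: v_def G_def norm_sgn sgn_div_norm dot_square_norm power2_eq_square)+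
  define h where "h t = g (x - t *\<^sub>R v)" for t
  have h': "(h has_real_derivative - (gradient g (x - t *\<^sub>R v) \<bullet> v)) (at t)" for t
  proof -
    have "(g has_derivative (\<lambda>k. k \<bullet> gradient g (x - t *\<^sub>R v))) (at (x - t *\<^sub>R v))"
      using GDERIV_gradient[OF diff] by (simp add: gderiv_def)
    moreover have "((\<lambda>t. x - t *\<^sub>R v) has_derivative (\<lambda>s. - (s *\<^sub>R v))) (at t)"
      by (auto intro!: derivative_eq_intros)
    ultimately have "((\<lambda>t. g (x - t *\<^sub>R v)) has_derivative
        (\<lambda>s. - (s *\<^sub>R v) \<bullet> gradient g (x - t *\<^sub>R v))) (at t)"
      by (rule has_derivative_compose[rotated])
    then show ?thesis
      unfolding has_field_derivative_def h_def
      by (rule has_derivative_eq_rhs) (auto simp: inner_commute mult.commute)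
  qed
  have slope: "- (gradient g (x - t *\<^sub>R v) \<bullet> v) \<le> - G + K * t / \<nu>" if t: "0 \<le> t" "t \<le> r" for t
  proof -
    have tv: "norm (t *\<^sub>R v) \<le> t" using v t by (simp add: mult_left_le)
    have "bounded (gradient g ` closed_segment a b)" for a b
      by (intro bounded_gradient_image diff conv compact_imp_bounded compact_segment)
    then have "norm (gradient g x - gradient g (x - t *\<^sub>R v))
        \<le> K * exp (L1 * norm (t *\<^sub>R v)) * norm (t *\<^sub>R v)"
      using symmetrically_smooth_exp_bound[OF sm, of x "x - t *\<^sub>R v"] L by (simp add: K_def G_def)
    also have "\<dots> \<le> K * exp \<nu> * t"
    proof -
      have "L1 * norm (t *\<^sub>R v) \<le> L1 * r" using L tv t by (intro mult_left_mono) auto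
      then show ?thesis using K0 t tv rL by (intro mult_mono mult_left_mono) auto
    qed
    finally have "norm (gradient g x - gradient g (x - t *\<^sub>R v)) \<le> K * t / \<nu>"
      by (simp add: exp_nu)
    moreover have "(gradient g x - gradient g (x - t *\<^sub>R v)) \<bullet> v
        \<le> norm (gradient g x - gradient g (x - t *\<^sub>R v)) * norm v"
      by (rule norm_cauchy_schwarz)
    moreover have "\<dots> \<le> norm (gradient g x - gradient g (x - t *\<^sub>R v))"
      using v by (simp add: mult_left_le)
    ultimately show ?thesis using v(2) by (simp add: inner_diff_left)
  qed
  \<comment> \<open>This is the integrated form of \<open>slope\<close>: \<open>h\<close> minus the
    quadratic is nonincreasing on \<open>[0, r]\<close>.\<close>
  have "h r - (- G * r + K * r\<^sup>2 / (2 * \<nu>)) \<le> h 0 - (- G * 0 + K * 0\<^sup>2 / (2 * \<nu>))"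
  proof (rule DERIV_nonpos_imp_nonincreasing[OF r0, of "\<lambda>t. h t - (- G * t + K * t\<^sup>2 / (2 * \<nu>))"])
    fix t assume t: "0 \<le> t" "t \<le> r"
    have "((\<lambda>t. h t - (- G * t + K * t\<^sup>2 / (2 * \<nu>))) has_real_derivative
        - (gradient g (x - t *\<^sub>R v) \<bullet> v) - (- G + K * t / \<nu>)) (at t)"
      using nu0 by (auto intro!: derivative_eq_intros h' simp: field_simps)
    with slope[OF t] show "\<exists>y. ((\<lambda>t. h t - (- G * t + K * t\<^sup>2 / (2 * \<nu>))) has_real_derivative y) (at t)
        \<and> y \<le> 0"
      by (intro exI conjI) auto
  qed
  then have "G * r - K * r\<^sup>2 / (2 * \<nu>) \<le> g x - g xstar"
    using min[of "x - r *\<^sub>R v"] by (simp add: h_def)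
  moreover have "G * r - K * r\<^sup>2 / (2 * \<nu>) = \<nu> * G\<^sup>2 / (2 * K)"
    using K0 nu0 by (simp add: r_def field_simps power2_eq_square)
  ultimately show ?thesis by (simp add: G_def K_def)
qed

text \<open>Expand the square. Convexity makes the subtracted cross term at least
  \<open>2 * (\<eta> / K) * \<delta>\<close>, and \<open>\<eta> \<le> \<nu> / 2\<close> with the gap
  bound keeps the quadratic term below half of that. One \<open>(\<eta> / K) * \<delta>\<close>
  survives, and splitting on whether \<open>L0\<close> or \<open>L1 * G\<close> dominates
  \<open>K\<close> removes \<open>K\<close>.\<close>

lemma sgd_step_distance:
  fixes g :: "'a::euclidean_space \<Rightarrow> real"
  assumes diff: "\<And>x. g differentiable (at x)" and conv: "convex_gradient g"
    and sm: "symmetrically_smooth L0 L1 g" and L: "0 < L0" "0 < L1"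
    and min: "\<And>y. g xstar \<le> g y" and nu: "\<nu> = exp (- \<nu>)" and eta: "0 < \<eta>" "\<eta> \<le> \<nu> / 2"
  shows "(norm (x - (\<eta> / (L0 + L1 * norm (gradient g x))) *\<^sub>R gradient g x - xstar))\<^sup>2
      \<le> (norm (x - xstar))\<^sup>2 - \<eta> / (2 * L0) * min (\<nu> * L0 / (4 * L1\<^sup>2)) (g x - g xstar)"
proof -
  define u where "u = gradient g x"
  define G where "G = norm u"
  define K where "K = L0 + L1 * G"
  define \<delta> where "\<delta> = g x - g xstar"
  have nu0: "0 < \<nu>" by (subst nu) simp
  have G0: "0 \<le> G" by (simp add: G_def)
  have K0: "0 < K" using L G0 by (simp add: K_def add_pos_nonneg)
  have d0: "0 \<le> \<delta>" using min by (simp add: \<delta>_def)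
  have gap: "\<nu> * G\<^sup>2 / (2 * K) \<le> \<delta>"
    using gradient_norm_le_gap[OF diff conv sm L min nu, of x] by (simp add: G_def K_def \<delta>_def u_def)
  have inner: "\<delta> \<le> u \<bullet> (x - xstar)"
    using conv by (auto simp: convex_gradient_def \<delta>_def u_def inner_diff_right
        dest!: spec2[of _ x xstar])
  have "(norm (x - (\<eta> / K) *\<^sub>R u - xstar))\<^sup>2
      = (norm (x - xstar))\<^sup>2 - 2 * (\<eta> / K) * (u \<bullet> (x - xstar)) + (\<eta> / K) * (\<eta> * G\<^sup>2 / K)"
  proof -
    have "(norm (a - c *\<^sub>R u))\<^sup>2 = (norm a)\<^sup>2 - 2 * c * (u \<bullet> a) + c * (c * (norm u)\<^sup>2)" for a c
      unfolding power2_norm_eq_inner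
      by (simp add: inner_diff_left inner_diff_right inner_commute algebra_simps)
    from this[of "x - xstar" "\<eta> / K"] show ?thesis
      by (simp add: G_def algebra_simps)
  qed
  moreover have "\<eta> * G\<^sup>2 / K \<le> \<delta>"
  proof -
    have "\<eta> * (G\<^sup>2 / K) \<le> (\<nu> / 2) * (G\<^sup>2 / K)"
      using eta K0 by (intro mult_right_mono) auto
    then show ?thesis using gap by simp
  qed
  then have "(\<eta> / K) * (\<eta> * G\<^sup>2 / K) \<le> (\<eta> / K) * \<delta>"
    using eta K0 by (intro mult_left_mono) auto
  moreover have "(\<eta> / K) * \<delta> \<le> (\<eta> / K) * (u \<bullet> (x - xstar))"
    using eta K0 inner by (intro mult_left_mono) auto
  moreover have "\<eta> / (2 * L0) * min (\<nu> * L0 / (4 * L1\<^sup>2)) \<delta> \<le> (\<eta> / K) * \<delta>"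
  proof (cases "L1 * G \<le> L0")
    case True
    have "\<eta> / (2 * L0) * min (\<nu> * L0 / (4 * L1\<^sup>2)) \<delta> \<le> \<eta> / (2 * L0) * \<delta>"
      using eta L by (intro mult_left_mono) auto
    also have "\<dots> \<le> (\<eta> / K) * \<delta>"
      using eta L True K0 d0 by (intro mult_right_mono divide_left_mono) (auto simp: K_def)
    finally show ?thesis .
  next
    case False
    then have Gp: "0 < G" using L G0 by (cases "G = 0") auto
    have K2: "K \<le> 2 * L1 * G" using False unfolding K_def by linarith
    have "\<eta> / (2 * L0) * min (\<nu> * L0 / (4 * L1\<^sup>2)) \<delta> \<le> \<eta> / (2 * L0) * (\<nu> * L0 / (4 * L1\<^sup>2))"
      using eta L by (intro mult_left_mono) auto
    \<comment> \<open>Both sides are \<open>\<eta> * \<nu> / (8 * L1\<^sup>2)\<close>; the threshold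
      in the minimum is chosen for this match. Inserting \<open>G\<close> prepares the comparison of
      \<open>2 * L1 * G\<close> with \<open>K\<close>.\<close>
    also have "\<dots> = \<eta> * (\<nu> * G\<^sup>2 / (2 * (2 * L1 * G)\<^sup>2))"
      using L Gp by (simp add: field_simps power2_eq_square)
    also have "\<dots> \<le> \<eta> * (\<nu> * G\<^sup>2 / (2 * K\<^sup>2))"
      using eta nu0 Gp L K0 K2
      by (intro mult_left_mono divide_left_mono power_mono mult_nonneg_nonneg) auto
    also have "\<dots> = (\<eta> / K) * (\<nu> * G\<^sup>2 / (2 * K))"
      by (simp add: power2_eq_square)
    also have "\<dots> \<le> (\<eta> / K) * \<delta>"
      using eta K0 by (intro mult_left_mono gap) auto
    finally show ?thesis .
  qed
  ultimately show ?thesis by (simp add: u_def G_def K_def \<delta>_def)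
qed

section \<open>Averaging over the sampled index\<close>

text \<open>If some term reaches \<open>c\<close>, its truncation alone suffices, as the others are
  nonnegative; otherwise truncation changes nothing. It turns truncated gaps of the components into
  the truncated gap of their sum.\<close>

lemma min_sum_le_sum_min:
  fixes a :: "'b \<Rightarrow> real"
  assumes "finite A" and "0 \<le> c" and "\<And>i. i \<in> A \<Longrightarrow> 0 \<le> a i"
  shows "min c (\<Sum>i\<in>A. a i) \<le> (\<Sum>i\<in>A. min c (a i))"
proof (cases "\<exists>i\<in>A. c \<le> a i")
  case True
  then obtain i where i: "i \<in> A" "c \<le> a i" by blast
  then have "c = min c (a i)" by simp
  also have "\<dots> \<le> (\<Sum>i\<in>A. min c (a i))"
    using assms i by (intro member_le_sum) auto
  finally show ?thesis by simp
next
  case False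
  then have "(\<Sum>i\<in>A. min c (a i)) = (\<Sum>i\<in>A. a i)"
    by (intro sum.cong) auto
  then show ?thesis by simp
qed

text \<open>A finite product of finite counting spaces is again a counting space, so every function
  of a prefix of sampled indices becomes measurable.\<close>

lemma (in prob_space) measurable_prefix:
  fixes \<xi> :: "nat \<Rightarrow> 'a \<Rightarrow> 'b"
  assumes "finite A" and "\<And>j. \<xi> j \<in> measurable M (count_space A)"
  shows "(\<lambda>\<omega>. restrict (\<lambda>j. \<xi> j \<omega>) {..<k}) \<in> measurable M (count_space ({..<k} \<rightarrow>\<^sub>E A))"
proof -
  have "(\<lambda>\<omega>. restrict (\<lambda>j. \<xi> j \<omega>) {..<k}) \<in> measurable M (PiM {..<k} (\<lambda>_. count_space A))"
    using assms by (intro measurable_restrict) auto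
  then show ?thesis
    using assms by (simp add: count_space_PiM_finite countable_finite)
qed

text \<open>There are only finitely many prefixes of length \<open>k\<close>, so the sum of
  \<open>\<bar>F p\<bar>\<close> over all of them is a uniform bound.\<close>

lemma (in prob_space) integrable_prefix:
  fixes \<xi> :: "nat \<Rightarrow> 'a \<Rightarrow> 'b" and F :: "(nat \<Rightarrow> 'b) \<Rightarrow> real"
  assumes A: "finite A" and \<xi>: "\<And>j. \<xi> j \<in> measurable M (count_space A)"
    and F: "\<And>s t. (\<And>j. j < k \<Longrightarrow> s j = t j) \<Longrightarrow> F s = F t"
  shows "integrable M (\<lambda>\<omega>. F (\<lambda>j. \<xi> j \<omega>))"
proof -
  let ?R = "\<lambda>\<omega>. restrict (\<lambda>j. \<xi> j \<omega>) {..<k}"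
  have R: "?R \<in> measurable M (count_space ({..<k} \<rightarrow>\<^sub>E A))"
    by (rule measurable_prefix[OF A \<xi>])
  have "integrable M (\<lambda>\<omega>. F (?R \<omega>))"
  proof (rule integrable_const_bound)
    show "AE \<omega> in M. norm (F (?R \<omega>)) \<le> (\<Sum>p\<in>{..<k} \<rightarrow>\<^sub>E A. \<bar>F p\<bar>)"
    proof (rule AE_I2)
      fix \<omega> assume "\<omega> \<in> space M"
      then have "?R \<omega> \<in> {..<k} \<rightarrow>\<^sub>E A"
        using measurable_space[OF R] by simp
      then show "norm (F (?R \<omega>)) \<le> (\<Sum>p\<in>{..<k} \<rightarrow>\<^sub>E A. \<bar>F p\<bar>)"
        using member_le_sum[of "?R \<omega>" "{..<k} \<rightarrow>\<^sub>E A" "\<lambda>p. \<bar>F p\<bar>"] A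
        by (simp add: finite_PiE)
    qed
    show "(\<lambda>\<omega>. F (?R \<omega>)) \<in> borel_measurable M"
      by (rule measurable_compose[OF R]) simp
  qed
  \<comment> \<open>From index \<open>k\<close> on, the restriction is \<open>undefined\<close>,
    which \<open>F\<close> does not see.\<close>
  moreover have "F (\<lambda>j. \<xi> j \<omega>) = F (?R \<omega>)" for \<omega>
    by (rule F) simp
  ultimately show ?thesis by simp
qed

text \<open>This plays the part of conditioning on the past. Split by the value \<open>i\<close> of
  the fresh index: each \<open>\<phi>\<close> term depends on the prefix alone, hence is independent
  of the event that \<open>i\<close> is drawn, which has probability
  \<open>1 / card A\<close>.\<close>

lemma (in prob_space) expectation_prefix_uniform_next:
  fixes \<xi> :: "nat \<Rightarrow> 'a \<Rightarrow> 'b" and \<phi> :: "(nat \<Rightarrow> 'b) \<Rightarrow> 'b \<Rightarrow> real"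
  assumes A: "finite A" and ind: "indep_vars (\<lambda>_. count_space A) \<xi> UNIV"
    and unif: "distr M (count_space A) (\<xi> k) = uniform_count_measure A"
    and \<phi>: "\<And>s t i. (\<And>j. j < k \<Longrightarrow> s j = t j) \<Longrightarrow> \<phi> s i = \<phi> t i"
  shows "expectation (\<lambda>\<omega>. \<phi> (\<lambda>j. \<xi> j \<omega>) (\<xi> k \<omega>))
      = expectation (\<lambda>\<omega>. (\<Sum>i\<in>A. \<phi> (\<lambda>j. \<xi> j \<omega>) i) / card A)"
proof -
  let ?P = "\<lambda>\<omega> j. \<xi> j \<omega>"
  let ?R = "\<lambda>\<omega>. restrict (?P \<omega>) {..<k}"
  have \<xi>: "\<xi> j \<in> measurable M (count_space A)" for j
    using ind by (simp add: indep_vars_def)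
  have int: "integrable M (\<lambda>\<omega>. \<phi> (?P \<omega>) i)" for i
    by (rule integrable_prefix[OF A \<xi>, of k]) (rule \<phi>)
  have ind_meas: "(\<lambda>\<omega>. indicator {i} (\<xi> k \<omega>) :: real) \<in> borel_measurable M" for i
    by (rule measurable_compose[OF \<xi>]) simp
  have int1: "integrable M (\<lambda>\<omega>. indicator {i} (\<xi> k \<omega>) :: real)" for i
    by (rule integrable_const_bound[where B = 1, OF _ ind_meas]) (auto simp: indicator_def)
  have iv: "indep_var borel (\<lambda>\<omega>. \<phi> (?P \<omega>) i) borel (\<lambda>\<omega>. indicator {i} (\<xi> k \<omega>) :: real)" for i
  proof -
    \<comment> \<open>The two factors read the disjoint index sets \<open>{..<k}\<close> and
      \<open>{k}\<close> of an independent family.\<close>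
    have "indep_var borel ((\<lambda>p. \<phi> p i) \<circ> ?R) borel
        ((\<lambda>p. indicator {i} (p k) :: real) \<circ> (\<lambda>\<omega>. restrict (?P \<omega>) {k}))"
    proof (rule indep_var_compose[OF indep_var_restrict[OF ind]])
      show "(\<lambda>p. \<phi> p i) \<in> borel_measurable (PiM {..<k} (\<lambda>_. count_space A))"
        using A by (simp add: count_space_PiM_finite countable_finite)
      show "(\<lambda>p. indicator {i} (p k) :: real) \<in> borel_measurable (PiM {k} (\<lambda>_. count_space A))"
        by (rule measurable_compose[OF measurable_component_singleton]) auto
    qed auto
    moreover have "\<phi> (?P \<omega>) i = \<phi> (?R \<omega>) i" for \<omega>
      by (rule \<phi>) simp
    ultimately show ?thesis by (simp add: comp_def)
  qed
  have E1: "expectation (\<lambda>\<omega>. indicator {i} (\<xi> k \<omega>)) = 1 / card A" if i: "i \<in> A" for i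
  proof -
    have "expectation (\<lambda>\<omega>. indicator {i} (\<xi> k \<omega>))
        = (\<integral>j. (indicator {i} j :: real) \<partial>distr M (count_space A) (\<xi> k))"
      by (rule integral_distr[OF \<xi>, symmetric]) simp
    also have "\<dots> = measure (uniform_count_measure A) {i}"
      using i by (simp add: unif space_uniform_count_measure)
    finally show ?thesis
      using A i by (simp add: measure_uniform_count_measure)
  qed
  have "expectation (\<lambda>\<omega>. \<phi> (?P \<omega>) (\<xi> k \<omega>))
      = expectation (\<lambda>\<omega>. \<Sum>i\<in>A. \<phi> (?P \<omega>) i * indicator {i} (\<xi> k \<omega>))"
  proof (rule Bochner_Integration.integral_cong[OF refl])
    fix \<omega> assume "\<omega> \<in> space M"
    then have "\<xi> k \<omega> \<in> A" using measurable_space[OF \<xi>] by simp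
    then show "\<phi> (?P \<omega>) (\<xi> k \<omega>) = (\<Sum>i\<in>A. \<phi> (?P \<omega>) i * indicator {i} (\<xi> k \<omega>))"
      using A by (simp add: indicator_def sum.delta' if_distrib[of "\<lambda>x. _ * x"] cong: if_cong)
  qed
  also have "\<dots> = (\<Sum>i\<in>A. expectation (\<lambda>\<omega>. \<phi> (?P \<omega>) i) * expectation (\<lambda>\<omega>. indicator {i} (\<xi> k \<omega>)))"
    by (simp add: indep_var_lebesgue_integral[OF iv int int1] indep_var_integrable[OF iv int int1])
  also have "\<dots> = (\<Sum>i\<in>A. expectation (\<lambda>\<omega>. \<phi> (?P \<omega>) i)) / card A"
    by (simp add: E1 sum_divide_distrib)
  also have "\<dots> = expectation (\<lambda>\<omega>. (\<Sum>i\<in>A. \<phi> (?P \<omega>) i) / card A)"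
    by (simp add: int)
  finally show ?thesis .
qed

section \<open>Expected descent and telescoping\<close>

lemma sgd_iterate_cong:
  "(\<And>j. j < k \<Longrightarrow> s j = t j) \<Longrightarrow> sgd_iterate L0 L1 \<eta> f x0 s k = sgd_iterate L0 L1 \<eta> f x0 t k"
  by (induction k) (simp_all add: Let_def)

theorem theorem7p2:
  fixes fi :: "nat \<Rightarrow> real ^ 'd \<Rightarrow> real" and f :: "real ^ 'd \<Rightarrow> real"
    and n N :: nat and L0 L1 \<nu> \<eta> :: real and x0 xstar :: "real ^ 'd"
    and M :: "'w measure" and \<xi> :: "nat \<Rightarrow> 'w \<Rightarrow> nat" and X :: "nat \<Rightarrow> 'w \<Rightarrow> real ^ 'd"
  assumes "n \<ge> 1"
    and "\<And>x. f x = (1 / real n) * (\<Sum>i=1..n. fi i x)"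
    and "L0 > 0" and "L1 > 0"
    and "\<And>i x. i \<in> {1..n} \<Longrightarrow> fi i differentiable (at x)"
    and "\<And>i. i \<in> {1..n} \<Longrightarrow> convex_gradient (fi i)"
    and "\<And>i. i \<in> {1..n} \<Longrightarrow> symmetrically_smooth L0 L1 (fi i)"
    and "\<And>i. i \<in> {1..n} \<Longrightarrow> is_arg_min (fi i) (\<lambda>_. True) xstar"
    and "\<nu> = exp (- \<nu>)"
    and "0 < \<eta>" and "\<eta> \<le> \<nu> / 2"
    and "prob_space M"
    and "prob_space.indep_vars M (\<lambda>_. count_space {1..n}) \<xi> UNIV"
    and "\<And>k. distr M (count_space {1..n}) (\<xi> k) = uniform_count_measure {1..n}"
    and "\<And>k \<omega>. X k \<omega> = sgd_iterate L0 L1 \<eta> fi x0 (\<lambda>j. \<xi> j \<omega>) k"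
  shows "(MIN k\<in>{0..N}. prob_space.expectation M
            (\<lambda>\<omega>. min (\<nu> * L0 / (4 * real n * L1\<^sup>2)) (f (X k \<omega>) - f xstar)))
         \<le> 2 * L0 * (norm (x0 - xstar))\<^sup>2 / (\<eta> * real (N + 1))"
proof -
  interpret prob_space M by fact
  let ?A = "{1..n}"
  note diff = assms(5) and conv = assms(6) and smooth = assms(7) and ind = assms(13) and unif = assms(14)
  have min: "fi i xstar \<le> fi i y" if "i \<in> ?A" for i y
    using assms(8)[OF that] by (auto simp: is_arg_min_def not_less)
  have nu0: "0 < \<nu>" by (subst assms(9)) simp
  have \<xi>: "\<xi> j \<in> measurable M (count_space ?A)" for j
    using ind by (simp add: indep_vars_def)
  \<comment> \<open>As a function of the index sequence instead of the outcome, the iterate fits the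
    prefix lemmas.\<close>
  define Y where "Y k s = sgd_iterate L0 L1 \<eta> fi x0 s k" for k s
  define T where "T x i = (norm (x - (\<eta> / (L0 + L1 * norm (gradient (fi i) x))) *\<^sub>R gradient (fi i) x - xstar))\<^sup>2"
    for x i
  define R where "R x = min (\<nu> * L0 / (4 * real n * L1\<^sup>2)) (f x - f xstar)" for x
  have XY: "X k \<omega> = Y k (\<lambda>j. \<xi> j \<omega>)" for k \<omega>
    by (simp add: Y_def assms(15))
  have Ycong: "Y k s = Y k t" if "\<And>j. j < k \<Longrightarrow> s j = t j" for k s t
    unfolding Y_def using that by (rule sgd_iterate_cong)
  have int: "integrable M (\<lambda>\<omega>. F (X k \<omega>))" for F :: "real ^ 'd \<Rightarrow> real" and k
    unfolding XY by (rule integrable_prefix[OF _ \<xi>, of k]) (simp, metis Ycong)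
  have step: "(\<Sum>i\<in>?A. T x i) / card ?A \<le> (norm (x - xstar))\<^sup>2 - \<eta> / (2 * L0) * R x" for x
  proof -
    let ?c = "\<nu> * L0 / (4 * L1\<^sup>2)"
    let ?S = "\<Sum>i\<in>?A. fi i x - fi i xstar"
    have "(\<Sum>i\<in>?A. T x i)
        \<le> (\<Sum>i\<in>?A. (norm (x - xstar))\<^sup>2 - \<eta> / (2 * L0) * min ?c (fi i x - fi i xstar))"
      unfolding T_def using assms
      by (intro sum_mono sgd_step_distance diff conv smooth min)
    also have "\<dots> = n * (norm (x - xstar))\<^sup>2
        - \<eta> / (2 * L0) * (\<Sum>i\<in>?A. min ?c (fi i x - fi i xstar))"
      by (simp add: sum_subtractf sum_distrib_left)
    also have "\<dots> \<le> n * (norm (x - xstar))\<^sup>2 - \<eta> / (2 * L0) * min ?c ?S"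
      using assms nu0 min
      by (intro diff_left_mono mult_left_mono min_sum_le_sum_min) auto
    \<comment> \<open>The component gaps sum to \<open>n\<close> times the gap of \<open>f\<close>;
      pulling \<open>n\<close> out of the minimum divides the threshold by \<open>n\<close>.\<close>
    also have "min ?c ?S = n * R x"
      using assms(1) by (simp add: R_def assms(2) sum_subtractf min_def field_simps)
    finally have "(\<Sum>i\<in>?A. T x i) \<le> ((norm (x - xstar))\<^sup>2 - \<eta> / (2 * L0) * R x) * n"
      by (simp add: algebra_simps)
    then show ?thesis using assms(1) by (simp add: pos_divide_le_eq)
  qed
  define D where "D k = expectation (\<lambda>\<omega>. (norm (X k \<omega> - xstar))\<^sup>2)" for k
  have descent: "D (Suc k) + \<eta> / (2 * L0) * expectation (\<lambda>\<omega>. R (X k \<omega>)) \<le> D k" for k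
  proof -
    have "D (Suc k) = expectation (\<lambda>\<omega>. T (Y k (\<lambda>j. \<xi> j \<omega>)) (\<xi> k \<omega>))"
      by (simp add: D_def XY T_def Y_def Let_def)
    \<comment> \<open>\<open>Y k\<close> reads only the indices below \<open>k\<close>, so
      \<open>\<xi> k\<close> is fresh and may be averaged out.\<close>
    also have "\<dots> = expectation (\<lambda>\<omega>. (\<Sum>i\<in>?A. T (Y k (\<lambda>j. \<xi> j \<omega>)) i) / card ?A)"
      by (rule expectation_prefix_uniform_next[OF _ ind unif]) (simp, metis Ycong)
    also have "\<dots> \<le> expectation (\<lambda>\<omega>. (norm (X k \<omega> - xstar))\<^sup>2 - \<eta> / (2 * L0) * R (X k \<omega>))"
      unfolding XY[symmetric] by (intro integral_mono int step)
    also have "\<dots> = D k - \<eta> / (2 * L0) * expectation (\<lambda>\<omega>. R (X k \<omega>))"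
      using int[of "\<lambda>x. (norm (x - xstar))\<^sup>2" k] int[of R k] by (simp add: D_def)
    finally show ?thesis by simp
  qed
  \<comment> \<open>Keeping \<open>D m\<close> on the left lets the induction close. At
    \<open>m = N + 1\<close> the strict sum covers exactly the indices \<open>0\<close> to
    \<open>N\<close>, and the nonnegative \<open>D (N + 1)\<close> is dropped.\<close>
  have telescope: "D m + \<eta> / (2 * L0) * (\<Sum>k<m. expectation (\<lambda>\<omega>. R (X k \<omega>))) \<le> D 0" for m
  proof (induction m)
    case (Suc m)
    then show ?case using descent[of m] by (simp add: distrib_left)
  qed simp
  define E where "E k = expectation (\<lambda>\<omega>. R (X k \<omega>))" for k
  have "0 \<le> D (N + 1)" by (simp add: D_def)
  moreover have "D 0 = (norm (x0 - xstar))\<^sup>2"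
    by (simp add: D_def XY Y_def prob_space)
  ultimately have "\<eta> / (2 * L0) * (\<Sum>k<N + 1. E k) \<le> (norm (x0 - xstar))\<^sup>2"
    using telescope[of "N + 1"] by (simp add: E_def)
  \<comment> \<open>The minimum is at most the average of the \<open>N + 1\<close>
    expectations.\<close>
  moreover have "real (N + 1) * (MIN k\<in>{0..N}. E k) \<le> (\<Sum>k<N + 1. E k)"
    using sum_bounded_below[of "{..<N + 1}" "MIN k\<in>{0..N}. E k" E] by (simp add: Min_le)
  then have "\<eta> / (2 * L0) * (real (N + 1) * (MIN k\<in>{0..N}. E k)) \<le> \<eta> / (2 * L0) * (\<Sum>k<N + 1. E k)"
    using assms by (intro mult_left_mono) auto
  ultimately have "\<eta> / (2 * L0) * (real (N + 1) * (MIN k\<in>{0..N}. E k)) \<le> (norm (x0 - xstar))\<^sup>2"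
    by linarith
  then have "(MIN k\<in>{0..N}. E k) \<le> 2 * L0 * (norm (x0 - xstar))\<^sup>2 / (\<eta> * real (N + 1))"
    using assms(3,10) by (simp add: field_simps del: of_nat_Suc)
  then show ?thesis by (simp only: E_def R_def)
qed

end
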